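(* Let $G$ be a group of order $n$ and $m\ge 1$ an integer. There is a one-to-one correspondence between the normalized $(G,m+1;1)$-difference matrices and the $\Phi(\mathcal{R}(G))$-invariant permutation codes $C\subseteq B_1$ consisting of $m\cdot n$ permutations, with minimum distance $n-1$, and containing the set $\Phi(\mathcal{R}(G))$.
   Context: Let $G=\{g_1=1_G,g_2,\ldots,g_n\}$. Permutations act on the right ($x^\sigma$ is the image of $x$ under $\sigma$, and $x^{\sigma\tau}=(x^\sigma)^\tau$). For $j\in\{1,\ldots,n\}$ let $\gamma_j\in S_G$ be given by $g^{\gamma_j}=gg_j$; $\mathcal{R}(G)=\{\gamma_1,\ldots,\gamma_n\}$ is the right regular representation. A $(G,m+1;1)$-difference matrix is an $(m+1)\times n$ matrix $D=(d_{ik})$, rows numbered $0,\ldots,m$, with entries in $G$ such that for any two distinct rows $i\ne j$ the elements $d_{ik}^{-1}d_{jk}$ ($k=1,\ldots,n$) are exactly the elements of $G$; it is normalized if all entries of row $0$ equal $1_G$ and $d_{1k}=g_k$ for all $k$. Let $B_1\cong S_n$ be the symmetric group on $\{1,\ldots,n\}$ and $\Phi:S_G\to B_1$ the natural isomorphism induced by $g_k\leftrightarrow k$. For $\sigma,\tau\in B_1$ the Hamming distance $d(\sigma,\tau)$ is $n$ minus the number of fixed points of $\sigma^{-1}\tau$; a permutation code is a subset $C\subseteq B_1$, with minimum distance $\min\{d(\sigma,\tau):\sigma,\tau\in C,\sigma\ne\tau\}$. The isometry group $\mathit{Iso}(n)=(B_1\times B_2):\langle t_n\rangle\le S_{2n}$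 (where $B_2$ is the symmetric group on $\{n+1,\ldots,2n\}$ and $t_n=(1,n+1)(2,n+2)\cdots(n,2n)$) acts on $B_1$ from the right by $b*x=x^{-1}b$ for $x\in B_1$, $b*x=b\varphi(x)$ for $x\in B_2$ (with $\varphi:B_2\to B_1$ the natural isomorphism), and $b*t_n=b^{-1}$. For a subgroup $U\le\mathit{Iso}(n)$, a code $C\subseteq B_1$ is $U$-invariant if $c*u\in C$ for all $c\in C$, $u\in U$; in particular for $U=\Phi(\mathcal{R}(G))\le B_1$ this means $C$ is closed under left multiplication by elements of $\Phi(\mathcal{R}(G))$.
   Formalization: Matrices are taken up to permuting rows 2..m and right-multiplying each by an element of G (for Z_3, m=2: 3 matrices, 1 code); minimum distance is "at least n-1", shown to equal n-1 for m≥2 (for m=1 it is n); the trivial group with m≥2 is excluded (a matrix exists, no code). *)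

theory Defs
  imports
    "HOL-Algebra.Coset"
    "HOL-Combinatorics.Permutations"
    "HOL-Library.Extended_Nat"
begin

section \<open>Permutations acting on the right\<close>

text \<open>Permutations act on the right, so the product \<open>\<sigma> \<odot> \<tau>\<close> applies \<open>\<sigma>\<close> first.
  The inverse of a permutation is written \<open>pinv\<close> because HOL-Algebra claims the
  notation \<open>inv\<close>.\<close>

abbreviation pmult :: "('x \<Rightarrow> 'x) \<Rightarrow> ('x \<Rightarrow> 'x) \<Rightarrow> 'x \<Rightarrow> 'x" (infixl "\<odot>" 70)
  where "\<sigma> \<odot> \<tau> \<equiv> \<tau> \<circ> \<sigma>"

abbreviation pinv :: "('x \<Rightarrow> 'x) \<Rightarrow> 'x \<Rightarrow> 'x"
  where "pinv \<equiv> inv_into UNIV"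

section \<open>Permutation codes and isometries\<close>

definition B1 :: "nat \<Rightarrow> (nat \<Rightarrow> nat) set"
  where "B1 n = {p. p permutes {1..n}}"

definition B2 :: "nat \<Rightarrow> (nat \<Rightarrow> nat) set"
  where "B2 n = {p. p permutes {n+1..2*n}}"

definition swap_halves :: "nat \<Rightarrow> nat \<Rightarrow> nat"
  where "swap_halves n k =
    (if k \<in> {1..n} then k + n else if k \<in> {n+1..2*n} then k - n else k)"

definition shift_down :: "nat \<Rightarrow> (nat \<Rightarrow> nat) \<Rightarrow> nat \<Rightarrow> nat"
  where "shift_down n y k = (if k \<in> {1..n} then y (k + n) - n else k)"

definition Iso :: "nat \<Rightarrow> (nat \<Rightarrow> nat) set"
  where "Iso n = {x \<odot> y | x y. x \<in> B1 n \<and> y \<in> B2 n}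
               \<union> {x \<odot> y \<odot> swap_halves n | x y. x \<in> B1 n \<and> y \<in> B2 n}"

text \<open>The right action of \<open>Iso n\<close> on \<open>B1 n\<close>. Every isometry is \<open>x \<odot> y\<close> or
  \<open>x \<odot> y \<odot> swap_halves n\<close> for unique \<open>x \<in> B1 n\<close>, \<open>y \<in> B2 n\<close>, and
  \<open>b * (x y t) = ((b * x) * y) * t\<close>.\<close>

definition iso_act :: "nat \<Rightarrow> (nat \<Rightarrow> nat) \<Rightarrow> (nat \<Rightarrow> nat) \<Rightarrow> nat \<Rightarrow> nat"
  where "iso_act n b u = (THE c. \<exists>x\<in>B1 n. \<exists>y\<in>B2 n.
      (u = x \<odot> y \<and> c = pinv x \<odot> b \<odot> shift_down n y) \<or>
      (u = x \<odot> y \<odot> swap_halves n \<and> c = pinv (pinv x \<odot> b \<odot> shift_down n y)))"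

definition code_invariant :: "nat \<Rightarrow> (nat \<Rightarrow> nat) set \<Rightarrow> (nat \<Rightarrow> nat) set \<Rightarrow> bool"
  where "code_invariant n U C \<longleftrightarrow> (\<forall>c\<in>C. \<forall>u\<in>U. iso_act n c u \<in> C)"

definition hamming_dist :: "nat \<Rightarrow> (nat \<Rightarrow> nat) \<Rightarrow> (nat \<Rightarrow> nat) \<Rightarrow> nat"
  where "hamming_dist n \<sigma> \<tau> = n - card {k \<in> {1..n}. (pinv \<sigma> \<odot> \<tau>) k = k}"

text \<open>The infimum is a minimum as soon as the code has two distinct elements;
  otherwise it is \<open>\<infinity>\<close>.\<close>

definition min_dist :: "nat \<Rightarrow> (nat \<Rightarrow> nat) set \<Rightarrow> enat"
  where "min_dist n C =
    Inf {enat (hamming_dist n \<sigma> \<tau>) | \<sigma> \<tau>. \<sigma> \<in> C \<and> \<tau> \<in> C \<and> \<sigma> \<noteq> \<tau>}"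

section \<open>Right regular representation\<close>

text \<open>\<open>g\<close> enumerates the group as \<open>g 1, \<dots>, g n\<close>.\<close>

definition right_translation :: "('a, 'b) monoid_scheme \<Rightarrow> 'a \<Rightarrow> 'a \<Rightarrow> 'a"
  where "right_translation G h x = (if x \<in> carrier G then x \<otimes>\<^bsub>G\<^esub> h else x)"

definition right_regular ::
  "('a, 'b) monoid_scheme \<Rightarrow> (nat \<Rightarrow> 'a) \<Rightarrow> nat \<Rightarrow> ('a \<Rightarrow> 'a) set"
  where "right_regular G g n = {right_translation G (g j) | j. j \<in> {1..n}}"

definition Phi :: "(nat \<Rightarrow> 'a) \<Rightarrow> nat \<Rightarrow> ('a \<Rightarrow> 'a) \<Rightarrow> nat \<Rightarrow> nat"
  where "Phi g n p k = (if k \<in> {1..n} then inv_into {1..n} g (p (g k)) else k)"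

definition PhiR :: "('a, 'b) monoid_scheme \<Rightarrow> (nat \<Rightarrow> 'a) \<Rightarrow> nat \<Rightarrow> (nat \<Rightarrow> nat) set"
  where "PhiR G g n = Phi g n ` right_regular G g n"

section \<open>Difference matrices\<close>

text \<open>The matrix for the parameters \<open>(G, m+1; 1)\<close>; the entry in row \<open>i\<close> and column \<open>k\<close>
  is \<open>D (i, k)\<close>. Extensionality makes equality of functions equality of matrices.\<close>

definition difference_matrix ::
  "('a, 'b) monoid_scheme \<Rightarrow> nat \<Rightarrow> nat \<Rightarrow> (nat \<times> nat \<Rightarrow> 'a) \<Rightarrow> bool"
  where "difference_matrix G n m D \<longleftrightarrow>
    D \<in> {0..m} \<times> {1..n} \<rightarrow>\<^sub>E carrier G \<and>
    (\<forall>i\<in>{0..m}. \<forall>j\<in>{0..m}. i \<noteq> j \<longrightarrow>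
       bij_betw (\<lambda>k. m_inv G (D (i, k)) \<otimes>\<^bsub>G\<^esub> D (j, k)) {1..n} (carrier G))"

definition normalized_dms ::
  "('a, 'b) monoid_scheme \<Rightarrow> (nat \<Rightarrow> 'a) \<Rightarrow> nat \<Rightarrow> nat \<Rightarrow> (nat \<times> nat \<Rightarrow> 'a) set"
  where "normalized_dms G g n m = {D. difference_matrix G n m D \<and>
    (\<forall>k\<in>{1..n}. D (0, k) = \<one>\<^bsub>G\<^esub>) \<and> (\<forall>k\<in>{1..n}. D (1, k) = g k)}"

text \<open>Permuting the rows \<open>2, \<dots>, m\<close> and multiplying each of them from the right by a group
  element turns a normalized difference matrix into another one, and is invisible to the
  associated code, which is a set of cosets of the regular representation. Normalized
  matrices are identified accordingly.\<close>

definition dm_equiv ::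
  "('a, 'b) monoid_scheme \<Rightarrow> (nat \<Rightarrow> 'a) \<Rightarrow> nat \<Rightarrow> nat \<Rightarrow>
   ((nat \<times> nat \<Rightarrow> 'a) \<times> (nat \<times> nat \<Rightarrow> 'a)) set"
  where "dm_equiv G g n m = {(D, D').
    D \<in> normalized_dms G g n m \<and> D' \<in> normalized_dms G g n m \<and>
    (\<exists>\<pi> c. \<pi> permutes {2..m} \<and> (\<forall>i\<in>{2..m}. c i \<in> carrier G) \<and>
      (\<forall>i\<in>{2..m}. \<forall>k\<in>{1..n}. D' (i, k) = D (\<pi> i, k) \<otimes>\<^bsub>G\<^esub> c i))}"

definition row_perm :: "(nat \<Rightarrow> 'a) \<Rightarrow> nat \<Rightarrow> (nat \<times> nat \<Rightarrow> 'a) \<Rightarrow> nat \<Rightarrow> nat \<Rightarrow> nat"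
  where "row_perm g n D i k = (if k \<in> {1..n} then inv_into {1..n} g (D (i, k)) else k)"

text \<open>The inverse is forced by the conventions: right multiplication of row \<open>i\<close> by a group
  element multiplies \<open>row_perm g n D i\<close> from the right by an element of \<open>PhiR G g n\<close>,
  whereas invariance of codes is about multiplication from the left.\<close>

definition dm_code ::
  "('a, 'b) monoid_scheme \<Rightarrow> (nat \<Rightarrow> 'a) \<Rightarrow> nat \<Rightarrow> nat \<Rightarrow> (nat \<times> nat \<Rightarrow> 'a) \<Rightarrow> (nat \<Rightarrow> nat) set"
  where "dm_code G g n m D =
    {\<gamma> \<odot> pinv (row_perm g n D i) | \<gamma> i. \<gamma> \<in> PhiR G g n \<and> i \<in> {1..m}}"

section \<open>The action of the isometry group is well defined\<close>

lemma B1_B2_decomp_unique: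
  assumes "x \<in> B1 n" "x' \<in> B1 n" "y \<in> B2 n" "y' \<in> B2 n" "x \<odot> y = x' \<odot> y'"
  shows "x = x' \<and> y = y'"
proof -
  have fx: "(x \<odot> y) k = x k" if "x \<in> B1 n" "y \<in> B2 n" "k \<in> {1..n}" for x y k
  proof -
    have "x k \<in> {1..n}"
      using that permutes_in_image[of x "{1..n}" k] by (simp add: B1_def)
    then show ?thesis
      using that permutes_not_in[of y "{n+1..2*n}" "x k"] by (simp add: B2_def)
  qed
  have "x k = x' k" for k
  proof (cases "k \<in> {1..n}")
    case True
    then show ?thesis using assms(5) fx[OF assms(1,3)] fx[OF assms(2,4)] by simp
  next
    case False
    then show ?thesis
      using assms permutes_not_in[of x "{1..n}" k] permutes_not_in[of x' "{1..n}" k]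
      by (simp add: B1_def)
  qed
  then have xx: "x = x'" by auto
  have "surj x" using assms(1) by (auto simp: B1_def dest: permutes_surj)
  then have "y = y'" by (rule surj_fun_eq) (use assms(5) xx in simp)
  with xx show ?thesis by simp
qed

lemma B1_B2_image:
  assumes "x \<in> B1 n" "y \<in> B2 n"
  shows "(x \<odot> y) ` {1..n} = {1..n}"
proof -
  have "x ` {1..n} = {1..n}" using assms(1) by (auto simp: B1_def permutes_image)
  moreover have "y ` {1..n} = id ` {1..n}"
    by (rule image_cong[OF refl]) (use assms(2) permutes_not_in[of y "{n+1..2*n}"] in \<open>simp add: B2_def\<close>)
  ultimately show ?thesis by (simp only: image_comp[symmetric]) simp
qed

lemma swap_halves_inj: "inj (swap_halves n)"
  by (rule inj_on_inverseI[of _ "swap_halves n"]) (auto simp: swap_halves_def)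

lemma iso_coset_disjoint:
  assumes "0 < n" "x \<in> B1 n" "y \<in> B2 n" "x' \<in> B1 n" "y' \<in> B2 n"
  shows "x \<odot> y \<noteq> x' \<odot> y' \<odot> swap_halves n"
proof
  assume eq: "x \<odot> y = x' \<odot> y' \<odot> swap_halves n"
  have "(x' \<odot> y' \<odot> swap_halves n) ` {1..n} = swap_halves n ` {1..n}"
    using B1_B2_image[OF assms(4,5)] by (simp only: image_comp[symmetric])
  then have "swap_halves n 1 \<in> {1..n}"
    using eq B1_B2_image[OF assms(2,3)] assms(1) by auto
  then show False using assms(1) by (auto simp: swap_halves_def)
qed

lemma iso_act_eq:
  assumes "0 < n" "x \<in> B1 n" "y \<in> B2 n"
  shows "iso_act n b (x \<odot> y) = pinv x \<odot> b \<odot> shift_down n y"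
    and "iso_act n b (x \<odot> y \<odot> swap_halves n) = pinv (pinv x \<odot> b \<odot> shift_down n y)"
proof -
  have swap: "p = q" if "p \<odot> swap_halves n = q \<odot> swap_halves n" for p q :: "nat \<Rightarrow> nat"
    using that by (simp add: fun.inj_map[OF swap_halves_inj, THEN injD])
  show "iso_act n b (x \<odot> y) = pinv x \<odot> b \<odot> shift_down n y"
    unfolding iso_act_def
  proof (rule the_equality, goal_cases)
    case 1
    show ?case using assms by blast
  next
    case (2 c)
    then obtain x' y' where *: "x' \<in> B1 n" "y' \<in> B2 n"
      "(x \<odot> y = x' \<odot> y' \<and> c = pinv x' \<odot> b \<odot> shift_down n y') \<or>
       x \<odot> y = x' \<odot> y' \<odot> swap_halves n"
      by blast
    then have eq: "x \<odot> y = x' \<odot> y'" and c: "c = pinv x' \<odot> b \<odot> shift_down n y'"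
      using iso_coset_disjoint[OF assms *(1,2)] by blast+
    then show ?case
      using B1_B2_decomp_unique[OF assms(2) *(1) assms(3) *(2) eq] by simp
  qed
  show "iso_act n b (x \<odot> y \<odot> swap_halves n) = pinv (pinv x \<odot> b \<odot> shift_down n y)"
    unfolding iso_act_def
  proof (rule the_equality, goal_cases)
    case 1
    show ?case using assms by blast
  next
    case (2 c)
    then obtain x' y' where *: "x' \<in> B1 n" "y' \<in> B2 n"
      "x' \<odot> y' = x \<odot> y \<odot> swap_halves n \<or>
       (x \<odot> y \<odot> swap_halves n = x' \<odot> y' \<odot> swap_halves n \<and>
        c = pinv (pinv x' \<odot> b \<odot> shift_down n y'))"
      by metis
    then have sw: "x \<odot> y \<odot> swap_halves n = x' \<odot> y' \<odot> swap_halves n"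
      and c: "c = pinv (pinv x' \<odot> b \<odot> shift_down n y')"
      using iso_coset_disjoint[OF assms(1) *(1,2) assms(2,3)] by blast+
    then show ?case
      using B1_B2_decomp_unique[OF assms(2) *(1) assms(3) *(2) swap[OF sw]] by simp
  qed
qed

lemma shift_down_id: "shift_down n id = id"
  by (auto simp: shift_down_def)

lemma iso_act_B1:
  assumes "0 < n" "x \<in> B1 n"
  shows "iso_act n b x = pinv x \<odot> b"
  using iso_act_eq(1)[OF assms, of id b] by (simp add: B2_def permutes_id shift_down_id)

lemma iso_act_B2:
  assumes "0 < n" "y \<in> B2 n"
  shows "iso_act n b y = b \<odot> shift_down n y"
  using iso_act_eq(1)[OF assms(1), of id y b] assms(2) by (simp add: B1_def permutes_id)

lemma iso_act_swap_halves:
  assumes "0 < n"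
  shows "iso_act n b (swap_halves n) = pinv b"
  using iso_act_eq(2)[OF assms, of id id b]
  by (simp add: B1_def B2_def permutes_id shift_down_id)

end

theory Submission
  imports Defs
begin

text \<open>Read row \<open>i \<ge> 1\<close> of a normalized difference matrix as a permutation \<open>\<rho>\<^sub>i\<close>. A fixed point \<open>k\<close>
  of \<open>\<sigma>\<^sup>-\<^sup>1 \<tau>\<close>, where \<open>\<sigma> = \<gamma>\<^sub>a \<rho>\<^sub>i\<^sup>-\<^sup>1\<close> and \<open>\<tau> = \<gamma>\<^sub>b \<rho>\<^sub>j\<^sup>-\<^sup>1\<close>, is the same as a column \<open>k\<close> with
  \<open>d\<^sub>i\<^sub>k\<^sup>-\<^sup>1 d\<^sub>j\<^sub>k = a\<^sup>-\<^sup>1 b\<close>. So the difference condition on rows \<open>i \<noteq> j\<close> says that any two elements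
  of the cosets \<open>\<R>(G) \<rho>\<^sub>i\<^sup>-\<^sup>1\<close> and \<open>\<R>(G) \<rho>\<^sub>j\<^sup>-\<^sup>1\<close> have distance \<open>n - 1\<close>, and an invariant
  code of size \<open>m n\<close> is a union of \<open>m\<close> such cosets, whose representatives are determined up to
  order and up to multiplication by \<open>\<R>(G)\<close>.\<close>

section \<open>Right translations as permutations of the index set\<close>

locale enumerated_group = group G for G (structure) +
  fixes g :: "nat \<Rightarrow> 'a" and n :: nat
  assumes enum: "bij_betw g {1..n} (carrier G)"
begin

declare One_nat_def [simp del]

abbreviation idx :: "'a \<Rightarrow> nat" where "idx \<equiv> inv_into {1..n} g"

abbreviation tr :: "'a \<Rightarrow> nat \<Rightarrow> nat" where "tr h \<equiv> Phi g n (right_translation G h)"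

text \<open>Since \<open>\<circ>\<close> applies its right argument first,
  \<open>c \<circ> tr h\<close> is the right-action product \<open>tr h \<odot> c\<close>. The set
  is thus the coset of the regular representation obtained by multiplying \<open>c\<close> from the
  left.\<close>

definition lcoset :: "(nat \<Rightarrow> nat) \<Rightarrow> (nat \<Rightarrow> nat) set"
  where "lcoset c = (\<lambda>h. c \<circ> tr h) ` carrier G"

lemma finite_carrier: "finite (carrier G)"
  using enum bij_betw_finite by blast

lemma card_carrier: "card (carrier G) = n"
  using bij_betw_same_card[OF enum] by simp

lemma n_pos: "0 < n"
  using card_carrier finite_carrier one_closed by (metis card_gt_0_iff empty_iff)

lemma g_closed [simp]: "k \<in> {1..n} \<Longrightarrow> g k \<in> carrier G"
  using enum by (auto simp: bij_betw_def)

lemma idx_closed: "x \<in> carrier G \<Longrightarrow> idx x \<in> {1..n}"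
  using enum inv_into_into[of x g "{1..n}"] by (auto simp: bij_betw_def)

lemma g_idx [simp]: "x \<in> carrier G \<Longrightarrow> g (idx x) = x"
  using enum by (auto simp: bij_betw_def f_inv_into_f)

lemma idx_g [simp]: "k \<in> {1..n} \<Longrightarrow> idx (g k) = k"
  using enum by (simp add: bij_betw_def)

lemma g_eq_iff: "k \<in> {1..n} \<Longrightarrow> l \<in> {1..n} \<Longrightarrow> g k = g l \<longleftrightarrow> k = l"
  using idx_g by metis

lemma tr_closed: "h \<in> carrier G \<Longrightarrow> k \<in> {1..n} \<Longrightarrow> tr h k \<in> {1..n}"
  using idx_closed[of "g k \<otimes> h"] by (simp add: Phi_def right_translation_def)

lemma g_tr: "h \<in> carrier G \<Longrightarrow> k \<in> {1..n} \<Longrightarrow> g (tr h k) = g k \<otimes> h"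
  by (simp add: Phi_def right_translation_def)

lemma tr_outside: "k \<notin> {1..n} \<Longrightarrow> tr h k = k"
  unfolding Phi_def by (rule if_not_P)

text \<open>Written with \<open>\<odot>\<close> this is the homomorphism property; the factors look
  reversed only because of \<open>\<circ>\<close>. After applying \<open>g\<close>, it is
  associativity in the group.\<close>

lemma tr_comp:
  assumes "a \<in> carrier G" "b \<in> carrier G"
  shows "tr b \<circ> tr a = tr (a \<otimes> b)"
proof
  fix k
  show "(tr b \<circ> tr a) k = tr (a \<otimes> b) k"
  proof (cases "k \<in> {1..n}")
    case True
    have "g (tr b (tr a k)) = g (tr (a \<otimes> b) k)"
      using assms True by (simp only: g_tr tr_closed m_closed g_closed m_assoc)
    then show ?thesis
      using assms True by (simp only: g_eq_iff tr_closed m_closed o_apply)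
  qed (simp add: tr_outside del: atLeastAtMost_iff)
qed

lemma tr_one: "tr \<one> = id"
proof
  fix k show "tr \<one> k = id k"
    by (cases "k \<in> {1..n}") (simp_all add: Phi_def right_translation_def)
qed

lemma tr_inv_comp:
  assumes "a \<in> carrier G"
  shows "tr (inv a) \<circ> tr a = id" "tr a \<circ> tr (inv a) = id"
  using assms by (simp_all add: tr_comp tr_one)

lemma pinv_tr: "a \<in> carrier G \<Longrightarrow> pinv (tr a) = tr (inv a)"
  using tr_inv_comp by (intro inv_unique_comp)

lemma tr_permutes: "a \<in> carrier G \<Longrightarrow> tr a permutes {1..n}"
  by (rule bij_imp_permutes[OF bij_betw_byWitness[of _ "tr (inv a)"]])
    (use tr_inv_comp[of a, unfolded fun_eq_iff] tr_closed[of a] tr_closed[of "inv a"] tr_outside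
      in \<open>simp_all add: image_subset_iff del: atLeastAtMost_iff\<close>)

text \<open>The regular action is free, so one test point, here the index \<open>1\<close>, and
  cancellation suffice.\<close>

lemma inj_on_tr: "inj_on tr (carrier G)"
proof (rule inj_onI)
  fix a b assume ab: "a \<in> carrier G" "b \<in> carrier G" "tr a = tr b"
  have "1 \<in> {1..n}" using n_pos by simp
  then have "g 1 \<otimes> a = g 1 \<otimes> b"
    using ab g_tr by metis
  then show "a = b" using ab \<open>1 \<in> {1..n}\<close> by (simp del: atLeastAtMost_iff)
qed

lemma PhiR_eq: "PhiR G g n = tr ` carrier G"
proof -
  have "right_regular G g n = right_translation G ` g ` {1..n}"
    by (auto simp: right_regular_def)
  then show ?thesis
    using enum by (auto simp: PhiR_def bij_betw_def)
qed

section \<open>Invariance and cosets of the regular representation\<close>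

lemma PhiR_eq_lcoset: "PhiR G g n = lcoset id"
  by (simp add: PhiR_eq lcoset_def)

lemma code_invariant_iff:
  "code_invariant n (PhiR G g n) C \<longleftrightarrow> (\<forall>c\<in>C. lcoset c \<subseteq> C)"
proof -
  have act: "iso_act n c (tr h) = c \<circ> tr (inv h)" if "h \<in> carrier G" for c h
    using that tr_permutes n_pos by (simp add: iso_act_B1 B1_def pinv_tr)
  have "code_invariant n (PhiR G g n) C \<longleftrightarrow> (\<forall>c\<in>C. \<forall>h\<in>carrier G. c \<circ> tr (inv h) \<in> C)"
    by (simp add: code_invariant_def PhiR_eq act)
  also have "\<dots> \<longleftrightarrow> (\<forall>c\<in>C. \<forall>h\<in>carrier G. c \<circ> tr h \<in> C)"
    by (metis inv_closed inv_inv)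
  finally show ?thesis by (auto simp: lcoset_def)
qed

lemma lcoset_self: "c \<in> lcoset c"
  using tr_one by (auto simp: lcoset_def intro!: image_eqI[of _ _ \<one>])

text \<open>A second translation is absorbed by the first. With reflexivity and symmetry this makes
  coset membership an equivalence relation, so cosets are equal or disjoint.\<close>

lemma lcoset_subset:
  assumes "c' \<in> lcoset c"
  shows "lcoset c' \<subseteq> lcoset c"
proof -
  obtain a where a: "a \<in> carrier G" "c' = c \<circ> tr a"
    using assms by (auto simp: lcoset_def)
  have "c' \<circ> tr h = c \<circ> tr (h \<otimes> a)" if "h \<in> carrier G" for h
    using a that by (simp add: comp_assoc tr_comp)
  then show ?thesis using a by (auto simp: lcoset_def)
qed

lemma lcoset_sym:
  assumes "c' \<in> lcoset c"
  shows "c \<in> lcoset c'"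
proof -
  obtain a where a: "a \<in> carrier G" "c' = c \<circ> tr a"
    using assms by (auto simp: lcoset_def)
  then have "c = c' \<circ> tr (inv a)"
    by (simp add: comp_assoc tr_inv_comp)
  then show ?thesis using a by (auto simp: lcoset_def)
qed

lemma lcoset_eqI: "c' \<in> lcoset c \<Longrightarrow> lcoset c' = lcoset c"
  using lcoset_subset lcoset_sym by blast

lemma lcoset_disjoint: "lcoset c \<noteq> lcoset c' \<Longrightarrow> lcoset c \<inter> lcoset c' = {}"
  using lcoset_eqI by blast

lemma lcoset_permutes:
  assumes "c permutes {1..n}" "c' \<in> lcoset c"
  shows "c' permutes {1..n}"
  using assms tr_permutes by (auto simp: lcoset_def intro: permutes_compose)

lemma finite_lcoset: "finite (lcoset c)"
  by (simp add: lcoset_def finite_carrier)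

lemma card_lcoset:
  assumes "c permutes {1..n}"
  shows "card (lcoset c) = n"
proof -
  have "inj_on (\<lambda>h. c \<circ> tr h) (carrier G)"
    using inj_on_tr fun.inj_map[OF permutes_inj[OF assms]]
    by (auto simp: inj_on_def dest: injD)
  then show ?thesis by (simp add: lcoset_def card_image card_carrier)
qed

section \<open>Hamming distances between translates\<close>

text \<open>A fixed point \<open>k\<close> means \<open>tr (inv a \<otimes> b) (r k) = s k\<close>;
  applying \<open>g\<close> and solving for the translation gives the quotient of the two rows in
  column \<open>k\<close>. This turns every distance in a code into a count of columns.\<close>

lemma hamming_dist_translates:
  assumes r: "r permutes {1..n}" and s: "s permutes {1..n}"
    and ab: "a \<in> carrier G" "b \<in> carrier G"
  shows "hamming_dist n (pinv r \<circ> tr a) (pinv s \<circ> tr b) =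
    n - card {k \<in> {1..n}. inv (g (r k)) \<otimes> g (s k) = inv a \<otimes> b}"
proof -
  have pinv: "pinv (pinv r \<circ> tr a) = tr (inv a) \<circ> r"
    using o_inv_distrib[OF permutes_bij[OF permutes_inv[OF r]] permutes_bij[OF tr_permutes[OF ab(1)]]] ab
    by (simp add: pinv_tr permutes_inv_inv[OF r])
  have "(pinv (pinv r \<circ> tr a) \<odot> (pinv s \<circ> tr b)) k = k
      \<longleftrightarrow> inv (g (r k)) \<otimes> g (s k) = inv a \<otimes> b" if k: "k \<in> {1..n}" for k
  proof -
    have rs: "r k \<in> {1..n}" "s k \<in> {1..n}"
      using r s k by (simp_all only: permutes_in_image)
    have "(pinv (pinv r \<circ> tr a) \<odot> (pinv s \<circ> tr b)) k = pinv s ((tr b \<circ> tr (inv a)) (r k))"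
      by (simp add: pinv)
    also have "\<dots> = pinv s (tr (inv a \<otimes> b) (r k))"
      using ab by (simp add: tr_comp)
    finally have "(pinv (pinv r \<circ> tr a) \<odot> (pinv s \<circ> tr b)) k = k
        \<longleftrightarrow> tr (inv a \<otimes> b) (r k) = s k"
      using permutes_inv_eq[OF s] by metis
    also have "\<dots> \<longleftrightarrow> g (r k) \<otimes> (inv a \<otimes> b) = g (s k)"
      using ab rs by (metis g_eq_iff g_tr inv_closed m_closed tr_closed)
    also have "\<dots> \<longleftrightarrow> inv (g (r k)) \<otimes> g (s k) = inv a \<otimes> b"
      using ab rs by (metis g_closed inv_closed inv_solve_left m_closed)
    finally show ?thesis .
  qed
  then have "{k \<in> {1..n}. (pinv (pinv r \<circ> tr a) \<odot> (pinv s \<circ> tr b)) k = k} =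
      {k \<in> {1..n}. inv (g (r k)) \<otimes> g (s k) = inv a \<otimes> b}"
    by blast
  then show ?thesis by (simp only: hamming_dist_def)
qed

text \<open>The quotient of a row by itself is \<open>\<one>\<close> in every column, whereas
  \<open>inv a \<otimes> b\<close> is not \<open>\<one>\<close>, so no column is counted.\<close>

lemma hamming_dist_same_row:
  assumes r: "r permutes {1..n}" and ab: "a \<in> carrier G" "b \<in> carrier G" and "a \<noteq> b"
  shows "hamming_dist n (pinv r \<circ> tr a) (pinv r \<circ> tr b) = n"
proof -
  have "inv a \<otimes> b \<noteq> \<one>"
    using ab \<open>a \<noteq> b\<close> by (metis inv_closed inv_equality inv_inv)
  moreover have "inv (g (r k)) \<otimes> g (r k) = \<one>" if "k \<in> {1..n}" for k
    using that r by (simp only: permutes_in_image g_closed l_inv)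
  ultimately have "{k \<in> {1..n}. inv (g (r k)) \<otimes> g (r k) = inv a \<otimes> b} = {}"
    by auto
  then show ?thesis using hamming_dist_translates[OF r r ab] by (simp only: card.empty diff_zero)
qed

lemma hamming_dist_self:
  assumes "s permutes {1..n}"
  shows "hamming_dist n s s = 0"
  using permutes_inverses[OF assms] by (simp add: hamming_dist_def del: atLeastAtMost_iff)

section \<open>Rows of a normalized matrix as permutations\<close>

lemma row_perm_eq:
  assumes "D \<in> normalized_dms G g n m" "i \<in> {1..m}" "k \<in> {1..n}"
  shows "g (row_perm g n D i k) = D (i, k)"
proof -
  have "D (i, k) \<in> carrier G"
    using assms by (auto simp: normalized_dms_def difference_matrix_def)
  then show ?thesis using assms(3) by (simp add: row_perm_def)
qed

lemma dm_bij_betw: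
  assumes "D \<in> normalized_dms G g n m" "i \<in> {0..m}" "j \<in> {0..m}" "i \<noteq> j"
  shows "bij_betw (\<lambda>k. inv (D (i, k)) \<otimes> D (j, k)) {1..n} (carrier G)"
  using assms by (auto simp: normalized_dms_def difference_matrix_def)

text \<open>Row 0 is constantly \<open>\<one>\<close>, so the difference condition between rows 0
  and \<open>i\<close> says that row \<open>i\<close> itself runs through the group.\<close>

lemma row_perm_permutes:
  assumes D: "D \<in> normalized_dms G g n m" and i: "i \<in> {1..m}"
  shows "row_perm g n D i permutes {1..n}"
proof -
  have cl: "D (i, k) \<in> carrier G" if "k \<in> {1..n}" for k
    using D i that by (auto simp: normalized_dms_def difference_matrix_def)
  have "bij_betw (\<lambda>k. inv (D (0, k)) \<otimes> D (i, k)) {1..n} (carrier G)"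
    using D i by (intro dm_bij_betw) auto
  moreover have "inv (D (0, k)) \<otimes> D (i, k) = D (i, k)" if "k \<in> {1..n}" for k
    using D that cl by (simp add: normalized_dms_def)
  ultimately have "bij_betw (\<lambda>k. D (i, k)) {1..n} (carrier G)"
    by (simp del: atLeastAtMost_iff cong: bij_betw_cong)
  then have "bij_betw (idx \<circ> (\<lambda>k. D (i, k))) {1..n} {1..n}"
    using bij_betw_inv_into[OF enum] by (rule bij_betw_trans)
  then have "bij_betw (row_perm g n D i) {1..n} {1..n}"
    by (rule bij_betw_cong[THEN iffD1, rotated]) (simp add: row_perm_def)
  then show ?thesis
    by (rule bij_imp_permutes) (auto simp: row_perm_def)
qed

lemma row_perm_1: "D \<in> normalized_dms G g n m \<Longrightarrow> row_perm g n D 1 = id"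
  by (auto simp: row_perm_def normalized_dms_def fun_eq_iff)

lemma dm_code_eq:
  "dm_code G g n m D = (\<Union>i\<in>{1..m}. lcoset (pinv (row_perm g n D i)))"
  unfolding dm_code_def PhiR_eq lcoset_def by blast

text \<open>By the difference condition the value \<open>inv a \<otimes> b\<close> is taken in
  exactly one column, which gives exactly one fixed point.\<close>

lemma hamming_dist_distinct_rows:
  assumes D: "D \<in> normalized_dms G g n m" and ij: "i \<in> {1..m}" "j \<in> {1..m}" "i \<noteq> j"
    and ab: "a \<in> carrier G" "b \<in> carrier G"
  shows "hamming_dist n (pinv (row_perm g n D i) \<circ> tr a) (pinv (row_perm g n D j) \<circ> tr b) = n - 1"
proof -
  have bij: "bij_betw (\<lambda>k. inv (D (i, k)) \<otimes> D (j, k)) {1..n} (carrier G)"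
    using D ij by (intro dm_bij_betw) auto
  have "inv a \<otimes> b \<in> carrier G" using ab by simp
  then obtain k where k: "k \<in> {1..n}" "inv (D (i, k)) \<otimes> D (j, k) = inv a \<otimes> b"
    unfolding bij_betw_imp_surj_on[OF bij, symmetric] by fastforce
  have "l = k" if "l \<in> {1..n}" "inv (D (i, l)) \<otimes> D (j, l) = inv a \<otimes> b" for l
    using inj_onD[OF bij_betw_imp_inj_on[OF bij], of l k] that k by simp
  with k have "{k \<in> {1..n}. inv (D (i, k)) \<otimes> D (j, k) = inv a \<otimes> b} = {k}"
    by blast
  moreover have "{k \<in> {1..n}. inv (g (row_perm g n D i k)) \<otimes> g (row_perm g n D j k) = inv a \<otimes> b}
      = {k \<in> {1..n}. inv (D (i, k)) \<otimes> D (j, k) = inv a \<otimes> b}"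
    using D ij by (intro Collect_cong conj_cong refl) (simp only: row_perm_eq)
  ultimately show ?thesis
    using hamming_dist_translates[OF row_perm_permutes[OF D ij(1)] row_perm_permutes[OF D ij(2)] ab]
    by simp
qed

text \<open>If the cosets were equal, one representative would be a translate of the other, and its
  distance to itself would be both \<open>n - 1\<close> and \<open>0\<close>. For
  \<open>n = 1\<close> all cosets do coincide.\<close>

lemma lcoset_rows_distinct:
  assumes D: "D \<in> normalized_dms G g n m" and ij: "i \<in> {1..m}" "j \<in> {1..m}" "i \<noteq> j"
    and "n \<ge> 2"
  shows "lcoset (pinv (row_perm g n D i)) \<noteq> lcoset (pinv (row_perm g n D j))"
proof
  let ?r = "pinv (row_perm g n D i)" and ?s = "pinv (row_perm g n D j)"
  assume "lcoset ?r = lcoset ?s"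
  then have "?r \<in> lcoset ?s" using lcoset_self by metis
  then obtain b where b: "b \<in> carrier G" "?r = ?s \<circ> tr b" by (auto simp: lcoset_def)
  \<comment> \<open>The first \<open>?r\<close> is row \<open>i\<close> translated by
    \<open>\<one>\<close>, the second is row \<open>j\<close> translated by
    \<open>b\<close>.\<close>
  have "hamming_dist n ?r ?r = n - 1"
    using hamming_dist_distinct_rows[OF D ij one_closed b(1)] b(2) by (simp add: tr_one)
  moreover have "hamming_dist n ?r ?r = 0"
    by (intro hamming_dist_self permutes_inv row_perm_permutes[OF D] ij)
  ultimately show False using \<open>n \<ge> 2\<close> by simp
qed

section \<open>From matrices to codes\<close>

text \<open>Distances are \<open>n\<close> inside a coset and \<open>n - 1\<close> between cosets of
  different rows. For \<open>m = 1\<close> the value \<open>n - 1\<close> does not occur, so only a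
  lower bound holds for all \<open>m\<close>.\<close>

lemma min_dist_dm_code:
  assumes D: "D \<in> normalized_dms G g n m"
  shows "enat (n - 1) \<le> min_dist n (dm_code G g n m D)"
  unfolding min_dist_def
proof (rule Inf_greatest, clarify)
  fix \<sigma> \<tau> assume st: "\<sigma> \<in> dm_code G g n m D" "\<tau> \<in> dm_code G g n m D" "\<sigma> \<noteq> \<tau>"
  let ?r = "\<lambda>i. row_perm g n D i"
  obtain i a where ia: "i \<in> {1..m}" "a \<in> carrier G" "\<sigma> = pinv (?r i) \<circ> tr a"
    using st(1) unfolding dm_code_eq lcoset_def by blast
  obtain j b where jb: "j \<in> {1..m}" "b \<in> carrier G" "\<tau> = pinv (?r j) \<circ> tr b"
    using st(2) unfolding dm_code_eq lcoset_def by blast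
  have "n - 1 \<le> hamming_dist n \<sigma> \<tau>"
  proof (cases "i = j")
    case True
    then have "a \<noteq> b" using st ia jb by auto
    then show ?thesis
      using True ia jb hamming_dist_same_row[OF row_perm_permutes[OF D ia(1)]] by simp
  next
    case False
    then show ?thesis using ia jb hamming_dist_distinct_rows[OF D] by simp
  qed
  then show "enat (n - 1) \<le> enat (hamming_dist n \<sigma> \<tau>)" by simp
qed

text \<open>The representatives of rows 1 and 2 attain the bound; \<open>n \<ge> 2\<close> ensures
  that they are different elements of the code.\<close>

lemma min_dist_dm_code_eq:
  assumes D: "D \<in> normalized_dms G g n m" and "n \<ge> 2" "m \<ge> 2"
  shows "min_dist n (dm_code G g n m D) = enat (n - 1)"
proof (rule antisym[OF _ min_dist_dm_code[OF D]])
  let ?c = "\<lambda>i. pinv (row_perm g n D i)"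
  have m: "1 \<in> {1..m}" "2 \<in> {1..m}" "(1::nat) \<noteq> 2" using \<open>m \<ge> 2\<close> by auto
  have "hamming_dist n (?c 1) (?c 2) = n - 1"
    using hamming_dist_distinct_rows[OF D m one_closed one_closed] by (simp add: tr_one)
  moreover have "?c 1 \<in> dm_code G g n m D" "?c 2 \<in> dm_code G g n m D"
    unfolding dm_code_eq using m lcoset_self by blast+
  moreover have "?c 1 \<noteq> ?c 2"
    using lcoset_rows_distinct[OF D m \<open>n \<ge> 2\<close>] by auto
  ultimately show "min_dist n (dm_code G g n m D) \<le> enat (n - 1)"
    unfolding min_dist_def by (intro Inf_lower) force
qed

text \<open>The distance condition is a lower bound to include \<open>m = 1\<close>, where the code
  is the regular representation: its minimum distance is \<open>n\<close>, or
  \<open>\<infinity>\<close> if \<open>n = 1\<close>.\<close>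

definition invariant_codes :: "nat \<Rightarrow> (nat \<Rightarrow> nat) set set"
  where "invariant_codes m = {C. C \<subseteq> B1 n \<and> code_invariant n (PhiR G g n) C \<and> card C = m * n \<and>
          min_dist n C \<ge> enat (n - 1) \<and> PhiR G g n \<subseteq> C}"

lemma dm_code_mem:
  assumes D: "D \<in> normalized_dms G g n m" and "m \<ge> 1" and nm: "n \<ge> 2 \<or> m = 1"
  shows "dm_code G g n m D \<in> invariant_codes m"
proof -
  let ?c = "\<lambda>i. pinv (row_perm g n D i)"
  have perm: "?c i permutes {1..n}" if "i \<in> {1..m}" for i
    using that D by (intro permutes_inv row_perm_permutes)
  have disj: "lcoset (?c i) \<inter> lcoset (?c j) = {}" if "i \<in> {1..m}" "j \<in> {1..m}" "i \<noteq> j" for i j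
  proof (rule lcoset_disjoint)
    \<comment> \<open>Two different indices in \<open>{1..m}\<close> exclude
      \<open>m = 1\<close>.\<close>
    have "n \<ge> 2" using nm that by auto
    then show "lcoset (?c i) \<noteq> lcoset (?c j)" using lcoset_rows_distinct[OF D that] by blast
  qed
  have "dm_code G g n m D \<subseteq> B1 n"
    unfolding dm_code_eq B1_def using perm lcoset_permutes by blast
  moreover have "code_invariant n (PhiR G g n) (dm_code G g n m D)"
    unfolding code_invariant_iff dm_code_eq using lcoset_subset by blast
  moreover have "card (dm_code G g n m D) = (\<Sum>i\<in>{1..m}. card (lcoset (?c i)))"
    unfolding dm_code_eq using disj finite_lcoset by (intro card_UN_disjoint) auto
  then have "card (dm_code G g n m D) = m * n"
    using perm by (simp add: card_lcoset)
  moreover have "lcoset id \<subseteq> dm_code G g n m D"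
    unfolding dm_code_eq using row_perm_1[OF D] \<open>m \<ge> 1\<close>
    by (intro UN_upper[of 1, THEN subset_trans[rotated]]) auto
  ultimately show ?thesis
    using min_dist_dm_code[OF D] by (simp add: invariant_codes_def PhiR_eq_lcoset)
qed

section \<open>Row operations and the fibres of the code map\<close>

text \<open>Pairs of a row permutation and a tuple of group elements invert and compose as in a
  wreath product. The tuple is transported along the permutation, whence the indices
  \<open>?p i\<close> and \<open>\<pi>' i\<close>.\<close>

lemma equiv_dm_equiv: "equiv (normalized_dms G g n m) (dm_equiv G g n m)"
proof (rule equivI)
  show "dm_equiv G g n m \<subseteq> normalized_dms G g n m \<times> normalized_dms G g n m"
    by (auto simp: dm_equiv_def)
  have cl: "D (i, k) \<in> carrier G"
    if "D \<in> normalized_dms G g n m" "i \<in> {2..m}" "k \<in> {1..n}" for D i k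
    using that by (auto simp: normalized_dms_def difference_matrix_def)
  show "refl_on (normalized_dms G g n m) (dm_equiv G g n m)"
  proof (rule refl_onI)
    fix D assume D: "D \<in> normalized_dms G g n m"
    then show "(D, D) \<in> dm_equiv G g n m"
      unfolding dm_equiv_def using cl[OF D] permutes_id[of "{2..m}"]
      by (auto intro!: exI[of _ id] exI[of _ "\<lambda>_. \<one>"])
  qed
  show "sym (dm_equiv G g n m)"
  proof (rule symI)
    fix D D' assume "(D, D') \<in> dm_equiv G g n m"
    then obtain \<pi> c where D: "D \<in> normalized_dms G g n m" and D': "D' \<in> normalized_dms G g n m"
      and \<pi>: "\<pi> permutes {2..m}" and c: "\<And>i. i \<in> {2..m} \<Longrightarrow> c i \<in> carrier G"
      and eq: "\<And>i k. i \<in> {2..m} \<Longrightarrow> k \<in> {1..n} \<Longrightarrow> D' (i, k) = D (\<pi> i, k) \<otimes> c i"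
      unfolding dm_equiv_def by blast
    let ?p = "pinv \<pi>"
    have p: "?p permutes {2..m}" using \<pi> by (rule permutes_inv)
    have p_in: "?p i \<in> {2..m}" if "i \<in> {2..m}" for i
      using that p by (simp only: permutes_in_image)
    have "D (i, k) = D' (?p i, k) \<otimes> inv (c (?p i))" if "i \<in> {2..m}" "k \<in> {1..n}" for i k
    proof -
      have "D' (?p i, k) = D (i, k) \<otimes> c (?p i)"
        using eq[OF p_in[OF that(1)] that(2)] permutes_inverses(1)[OF \<pi>] by simp
      then show ?thesis
        using cl[OF D that] c[OF p_in[OF that(1)]] by (simp add: m_assoc)
    qed
    moreover have "inv (c (?p i)) \<in> carrier G" if "i \<in> {2..m}" for i
      using c[OF p_in[OF that]] by simp
    ultimately show "(D', D) \<in> dm_equiv G g n m"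
      unfolding dm_equiv_def using D D' p
      by (auto intro!: exI[of _ ?p] exI[of _ "\<lambda>i. inv (c (?p i))"])
  qed
  show "trans (dm_equiv G g n m)"
  proof (rule transI)
    fix D D' D''
    assume E: "(D, D') \<in> dm_equiv G g n m" and E': "(D', D'') \<in> dm_equiv G g n m"
    obtain \<pi> c where D: "D \<in> normalized_dms G g n m"
      and \<pi>: "\<pi> permutes {2..m}" and c: "\<And>i. i \<in> {2..m} \<Longrightarrow> c i \<in> carrier G"
      and eq: "\<And>i k. i \<in> {2..m} \<Longrightarrow> k \<in> {1..n} \<Longrightarrow> D' (i, k) = D (\<pi> i, k) \<otimes> c i"
      using E unfolding dm_equiv_def by blast
    obtain \<pi>' c' where D'': "D'' \<in> normalized_dms G g n m"
      and \<pi>': "\<pi>' permutes {2..m}" and c': "\<And>i. i \<in> {2..m} \<Longrightarrow> c' i \<in> carrier G"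
      and eq': "\<And>i k. i \<in> {2..m} \<Longrightarrow> k \<in> {1..n} \<Longrightarrow> D'' (i, k) = D' (\<pi>' i, k) \<otimes> c' i"
      using E' unfolding dm_equiv_def by blast
    have in': "\<pi>' i \<in> {2..m}" and in'': "\<pi> (\<pi>' i) \<in> {2..m}" if "i \<in> {2..m}" for i
      using that \<pi> \<pi>' by (simp_all only: permutes_in_image)
    have "D'' (i, k) = D ((\<pi> \<circ> \<pi>') i, k) \<otimes> (c (\<pi>' i) \<otimes> c' i)" if "i \<in> {2..m}" "k \<in> {1..n}" for i k
      using eq'[OF that] eq[OF in'[OF that(1)] that(2)] cl[OF D in''[OF that(1)] that(2)]
        c[OF in'[OF that(1)]] c'[OF that(1)] by (simp add: m_assoc)
    moreover have "c (\<pi>' i) \<otimes> c' i \<in> carrier G" if "i \<in> {2..m}" for i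
      using c[OF in'[OF that]] c'[OF that] by simp
    moreover have "\<pi> \<circ> \<pi>' permutes {2..m}" using \<pi>' \<pi> by (rule permutes_compose)
    ultimately show "(D, D'') \<in> dm_equiv G g n m"
      unfolding dm_equiv_def using D D''
      by (auto intro!: exI[of _ "\<pi> \<circ> \<pi>'"] exI[of _ "\<lambda>i. c (\<pi>' i) \<otimes> c' i"])
  qed
qed

text \<open>Multiplying a row by \<open>c\<close> from the right replaces its permutation
  \<open>\<rho>\<close> by \<open>tr c \<circ> \<rho>\<close>, with inverse
  \<open>pinv \<rho> \<circ> tr (inv c)\<close>. So a coset determines its row exactly up to right
  multiplication.\<close>

lemma pinv_row_perm_in_lcoset_iff:
  assumes D: "D \<in> normalized_dms G g n m" and D': "D' \<in> normalized_dms G g n m"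
    and i: "i \<in> {1..m}" and j: "j \<in> {1..m}"
  shows "pinv (row_perm g n D' i) \<in> lcoset (pinv (row_perm g n D j)) \<longleftrightarrow>
    (\<exists>c\<in>carrier G. \<forall>k\<in>{1..n}. D' (i, k) = D (j, k) \<otimes> c)"
proof -
  let ?r = "row_perm g n D j" and ?s = "row_perm g n D' i"
  have r: "?r permutes {1..n}" and s: "?s permutes {1..n}"
    using row_perm_permutes D D' i j by blast+
  have key: "pinv ?s = pinv ?r \<circ> tr (inv c) \<longleftrightarrow> (\<forall>k\<in>{1..n}. D' (i, k) = D (j, k) \<otimes> c)"
    if c: "c \<in> carrier G" for c
  proof -
    have "pinv ?r \<circ> tr (inv c) = pinv (tr c \<circ> ?r)"
      using o_inv_distrib[OF permutes_bij[OF tr_permutes[OF c]] permutes_bij[OF r]] c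
      by (simp add: pinv_tr)
    then have "pinv ?s = pinv ?r \<circ> tr (inv c) \<longleftrightarrow> ?s = tr c \<circ> ?r"
      using s permutes_compose[OF r tr_permutes[OF c]] by (metis permutes_inv_inv)
    also have "\<dots> \<longleftrightarrow> (\<forall>k\<in>{1..n}. ?s k = tr c (?r k))"
    proof
      assume eq: "\<forall>k\<in>{1..n}. ?s k = tr c (?r k)"
      show "?s = tr c \<circ> ?r"
      proof
        fix k show "?s k = (tr c \<circ> ?r) k"
          using eq permutes_not_in[OF s] permutes_not_in[OF r] tr_outside
          by (cases "k \<in> {1..n}") (simp_all del: atLeastAtMost_iff)
      qed
    qed simp
    also have "\<dots> \<longleftrightarrow> (\<forall>k\<in>{1..n}. D' (i, k) = D (j, k) \<otimes> c)"
    proof (intro ball_cong refl)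
      fix k assume k: "k \<in> {1..n}"
      have in': "?r k \<in> {1..n}" "?s k \<in> {1..n}"
        using k r s by (simp_all only: permutes_in_image)
      have "?s k = tr c (?r k) \<longleftrightarrow> g (?s k) = g (tr c (?r k))"
        using in' c by (simp only: g_eq_iff tr_closed)
      also have "\<dots> \<longleftrightarrow> D' (i, k) = D (j, k) \<otimes> c"
        using in' c k D D' i j by (simp only: g_tr row_perm_eq)
      finally show "?s k = tr c (?r k) \<longleftrightarrow> D' (i, k) = D (j, k) \<otimes> c" .
    qed
    finally show ?thesis .
  qed
  have "pinv ?s \<in> lcoset (pinv ?r) \<longleftrightarrow> (\<exists>c\<in>carrier G. pinv ?s = pinv ?r \<circ> tr (inv c))"
    unfolding lcoset_def image_iff by (metis inv_closed inv_inv)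
  then show ?thesis using key by blast
qed

text \<open>The coset of row \<open>i\<close> of \<open>D'\<close> is that of row
  \<open>\<pi> i\<close> of \<open>D\<close>, and row 1 is common to both. The reverse inclusion
  follows by symmetry of the relation.\<close>

lemma dm_code_mono_of_equiv:
  assumes "(D, D') \<in> dm_equiv G g n m"
  shows "dm_code G g n m D' \<subseteq> dm_code G g n m D"
proof -
  obtain \<pi> c where D: "D \<in> normalized_dms G g n m" and D': "D' \<in> normalized_dms G g n m"
    and \<pi>: "\<pi> permutes {2..m}" and c: "\<And>i. i \<in> {2..m} \<Longrightarrow> c i \<in> carrier G"
    and eq: "\<And>i k. i \<in> {2..m} \<Longrightarrow> k \<in> {1..n} \<Longrightarrow> D' (i, k) = D (\<pi> i, k) \<otimes> c i"
    using assms unfolding dm_equiv_def by blast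
  have "\<exists>j\<in>{1..m}. lcoset (pinv (row_perm g n D' i)) \<subseteq> lcoset (pinv (row_perm g n D j))"
    if i: "i \<in> {1..m}" for i
  proof (cases "i = 1")
    case True
    then show ?thesis
      using i row_perm_1[OF D] row_perm_1[OF D'] by (intro bexI[of _ 1]) auto
  next
    case False
    then have i2: "i \<in> {2..m}" using i by auto
    then have "\<pi> i \<in> {2..m}" using \<pi> by (simp only: permutes_in_image)
    then have "\<pi> i \<in> {1..m}" by auto
    moreover from this have "pinv (row_perm g n D' i) \<in> lcoset (pinv (row_perm g n D (\<pi> i)))"
      using pinv_row_perm_in_lcoset_iff[OF D D' i] c[OF i2] eq[OF i2] by blast
    ultimately show ?thesis using lcoset_subset by blast
  qed
  then show ?thesis unfolding dm_code_eq by blast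
qed

lemma dm_code_eq_of_equiv:
  assumes "(D, D') \<in> dm_equiv G g n m"
  shows "dm_code G g n m D = dm_code G g n m D'"
proof (rule subset_antisym)
  have "(D', D) \<in> dm_equiv G g n m"
    using equiv_dm_equiv assms by (auto simp: equiv_def dest: symD)
  then show "dm_code G g n m D \<subseteq> dm_code G g n m D'" by (rule dm_code_mono_of_equiv)
  show "dm_code G g n m D' \<subseteq> dm_code G g n m D" using assms by (rule dm_code_mono_of_equiv)
qed

text \<open>Each row of \<open>D'\<close> has its representative in the coset of some row
  \<open>p i\<close> of \<open>D\<close>. Different rows have different cosets, so \<open>p\<close>
  is injective, and restricting it to \<open>{2..m}\<close> gives the required row
  permutation.\<close>

lemma equiv_of_dm_code_eq:
  assumes D: "D \<in> normalized_dms G g n m" and D': "D' \<in> normalized_dms G g n m"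
    and eq: "dm_code G g n m D = dm_code G g n m D'" and nm: "n \<ge> 2 \<or> m = 1" and "m \<ge> 1"
  shows "(D, D') \<in> dm_equiv G g n m"
proof -
  let ?c = "\<lambda>i. pinv (row_perm g n D i)" and ?c' = "\<lambda>i. pinv (row_perm g n D' i)"
  have "\<exists>j\<in>{1..m}. ?c' i \<in> lcoset (?c j)" if "i \<in> {1..m}" for i
  proof -
    have "?c' i \<in> dm_code G g n m D"
      unfolding eq unfolding dm_code_eq using that lcoset_self by (rule UN_I)
    then show ?thesis by (auto simp: dm_code_eq)
  qed
  then obtain p where p: "\<And>i. i \<in> {1..m} \<Longrightarrow> p i \<in> {1..m}"
    and pc: "\<And>i. i \<in> {1..m} \<Longrightarrow> ?c' i \<in> lcoset (?c (p i))"
    by metis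
  have inj: "inj_on p {1..m}"
  proof (rule inj_onI, rule ccontr)
    fix i j assume ij: "i \<in> {1..m}" "j \<in> {1..m}" "p i = p j" "i \<noteq> j"
    then have "n \<ge> 2" using nm by auto
    moreover have "lcoset (?c' i) = lcoset (?c' j)"
      using lcoset_eqI[OF pc[OF ij(1)]] lcoset_eqI[OF pc[OF ij(2)]] ij(3) by simp
    ultimately show False using lcoset_rows_distinct[OF D' ij(1,2,4)] by blast
  qed
  have m1: "1 \<in> {1..m}" using \<open>m \<ge> 1\<close> by simp
  \<comment> \<open>Row 1 of either matrix is the identity permutation, so its coset is the regular
    representation in both codes.\<close>
  have p1: "p 1 = 1"
  proof (rule ccontr)
    assume ne: "p 1 \<noteq> 1"
    then have "n \<ge> 2" using nm p[OF m1] by auto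
    moreover have "lcoset (?c (p 1)) = lcoset (?c 1)"
      using lcoset_eqI[OF pc[OF m1]] row_perm_1[OF D] row_perm_1[OF D'] by simp
    ultimately show False using lcoset_rows_distinct[OF D p[OF m1] m1 ne] by blast
  qed
  define \<pi> where "\<pi> i = (if i \<in> {2..m} then p i else i)" for i
  have p2: "p i \<in> {2..m}" if "i \<in> {2..m}" for i
  proof -
    have "i \<in> {1..m}" "i \<noteq> 1" using that by auto
    then have "p i \<in> {1..m}" "p i \<noteq> 1" using p inj_onD[OF inj, of i 1] m1 p1 by auto
    then show ?thesis by auto
  qed
  have "inj_on p {2..m}"
    using inj by (rule inj_on_subset) auto
  then have "inj_on \<pi> {2..m}"
    by (simp add: \<pi>_def del: atLeastAtMost_iff cong: inj_on_cong)
  moreover have "\<pi> ` {2..m} \<subseteq> {2..m}"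
    using p2 by (simp add: \<pi>_def image_subset_iff del: atLeastAtMost_iff)
  ultimately have "bij_betw \<pi> {2..m} {2..m}"
    by (simp add: bij_betw_def endo_inj_surj)
  then have \<pi>: "\<pi> permutes {2..m}"
    by (rule bij_imp_permutes) (simp add: \<pi>_def del: atLeastAtMost_iff)
  have "\<exists>c\<in>carrier G. \<forall>k\<in>{1..n}. D' (i, k) = D (\<pi> i, k) \<otimes> c" if "i \<in> {2..m}" for i
  proof -
    have i: "i \<in> {1..m}" using that by auto
    show ?thesis
      using pc[OF i] pinv_row_perm_in_lcoset_iff[OF D D' i p[OF i]] that by (simp add: \<pi>_def)
  qed
  then obtain c where "\<And>i. i \<in> {2..m} \<Longrightarrow> c i \<in> carrier G"
    "\<And>i k. i \<in> {2..m} \<Longrightarrow> k \<in> {1..n} \<Longrightarrow> D' (i, k) = D (\<pi> i, k) \<otimes> c i"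
    by metis
  then show ?thesis
    unfolding dm_equiv_def using D D' \<pi> by blast
qed

section \<open>From codes to matrices\<close>

lemma invariant_code_representatives:
  assumes C: "C \<in> invariant_codes m" and "m \<ge> 1"
  obtains c where "c 1 = id" "C = (\<Union>i\<in>{1..m}. lcoset (c i))"
    "\<And>i j. i \<in> {1..m} \<Longrightarrow> j \<in> {1..m} \<Longrightarrow> i \<noteq> j \<Longrightarrow> lcoset (c i) \<inter> lcoset (c j) = {}"
proof -
  have CB: "\<And>c. c \<in> C \<Longrightarrow> c permutes {1..n}" and inv: "\<And>c. c \<in> C \<Longrightarrow> lcoset c \<subseteq> C"
    and card: "card C = m * n" and R: "lcoset id \<subseteq> C"
    using C unfolding invariant_codes_def code_invariant_iff B1_def PhiR_eq_lcoset[symmetric]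
    by blast+
  let ?K = "lcoset ` C"
  have "card C > 0" using card n_pos \<open>m \<ge> 1\<close> by simp
  then have fin: "finite C" using card_gt_0_iff by blast
  have Un: "\<Union>?K = C" using inv lcoset_self by blast
  \<comment> \<open>The cosets in \<open>C\<close> partition it into blocks of size
    \<open>n\<close>, so the size \<open>m * n\<close> forces exactly \<open>m\<close>
    blocks.\<close>
  have "n * card ?K = card (\<Union>?K)"
  proof (rule card_partition)
    show "finite ?K" "finite (\<Union>?K)" using fin Un by simp_all
    show "card X = n" if "X \<in> ?K" for X using that CB card_lcoset by blast
    show "X \<inter> Y = {}" if "X \<in> ?K" "Y \<in> ?K" "X \<noteq> Y" for X Y
      using that by (elim imageE) (simp add: lcoset_disjoint)
  qed
  then have K: "card ?K = m" using Un card n_pos by simp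
  have RK: "lcoset id \<in> ?K" using R lcoset_self by blast
  \<comment> \<open>Index 1 is reserved for the regular representation; the other
    \<open>m - 1\<close> cosets are numbered \<open>2\<close> to \<open>m\<close> in an arbitrary
    order.\<close>
  have "card {2..m} = card (?K - {lcoset id})"
    using K RK fin by simp
  then obtain f where f: "bij_betw f {2..m} (?K - {lcoset id})"
    using finite_same_card_bij[of "{2..m}" "?K - {lcoset id}"] fin by auto
  have "\<exists>d\<in>C. lcoset d = f i" if "i \<in> {2..m}" for i
  proof -
    have "f i \<in> ?K" using bij_betwE[OF f] that by blast
    then show ?thesis unfolding image_iff by metis
  qed
  then obtain d where d: "\<And>i. i \<in> {2..m} \<Longrightarrow> lcoset (d i) = f i"
    by metis
  define c where "c i = (if i = 1 then id else d i)" for i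
  have c: "lcoset (c i) = f i" if "i \<in> {2..m}" for i
    using d[OF that] that by (simp add: c_def)
  have split: "{1..m} = insert 1 {2..m}" using \<open>m \<ge> 1\<close> by auto
  have "lcoset (c 1) = lcoset id" by (simp add: c_def)
  moreover have im: "(\<lambda>i. lcoset (c i)) ` {2..m} = ?K - {lcoset id}"
    using bij_betw_imp_surj_on[OF f] c by (simp del: atLeastAtMost_iff)
  moreover have inj2: "inj_on (\<lambda>i. lcoset (c i)) {2..m}"
    using bij_betw_imp_inj_on[OF f] c by (simp del: atLeastAtMost_iff cong: inj_on_cong)
  ultimately have "(\<lambda>i. lcoset (c i)) ` {1..m} = ?K" and inj: "inj_on (\<lambda>i. lcoset (c i)) {1..m}"
    unfolding split using RK by auto
  then have "C = (\<Union>i\<in>{1..m}. lcoset (c i))" using Un by metis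
  moreover have "lcoset (c i) \<inter> lcoset (c j) = {}" if "i \<in> {1..m}" "j \<in> {1..m}" "i \<noteq> j" for i j
    using lcoset_disjoint inj_onD[OF inj] that by metis
  moreover have "c 1 = id" by (simp add: c_def)
  ultimately show ?thesis using that by blast
qed

text \<open>Two columns with the same quotient would produce two code elements agreeing in two
  places, at a distance below \<open>n - 1\<close>.\<close>

lemma inj_on_quotient_rows:
  assumes dist: "enat (n - 1) \<le> min_dist n C"
    and r: "r permutes {1..n}" and s: "s permutes {1..n}"
    and C: "lcoset (pinv r) \<subseteq> C" "lcoset (pinv s) \<subseteq> C"
    and disj: "lcoset (pinv r) \<inter> lcoset (pinv s) = {}"
  shows "inj_on (\<lambda>k. inv (g (r k)) \<otimes> g (s k)) {1..n}"
proof (rule inj_onI)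
  fix k l assume k: "k \<in> {1..n}" and l: "l \<in> {1..n}"
    and eq: "inv (g (r k)) \<otimes> g (s k) = inv (g (r l)) \<otimes> g (s l)"
  let ?b = "inv (g (r k)) \<otimes> g (s k)"
  have "r k \<in> {1..n}" "s k \<in> {1..n}"
    using k r s by (simp_all only: permutes_in_image)
  then have b: "?b \<in> carrier G" by simp
  \<comment> \<open>The translations \<open>\<one>\<close> and \<open>?b\<close> are chosen such
    that the columns \<open>k\<close> and \<open>l\<close> are both counted.\<close>
  let ?F = "{k \<in> {1..n}. inv (g (r k)) \<otimes> g (s k) = inv \<one> \<otimes> ?b}"
  have "pinv r \<circ> tr \<one> \<in> lcoset (pinv r)" "pinv s \<circ> tr ?b \<in> lcoset (pinv s)"
    using b by (auto simp: lcoset_def)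
  then have "pinv r \<circ> tr \<one> \<in> C" "pinv s \<circ> tr ?b \<in> C" "pinv r \<circ> tr \<one> \<noteq> pinv s \<circ> tr ?b"
    using C disj by (blast, blast, metis IntI empty_iff)
  then have "min_dist n C \<le> enat (hamming_dist n (pinv r \<circ> tr \<one>) (pinv s \<circ> tr ?b))"
    unfolding min_dist_def by (intro Inf_lower) blast
  then have "enat (n - 1) \<le> enat (n - card ?F)"
    unfolding hamming_dist_translates[OF r s one_closed b] by (rule order_trans[OF dist])
  then have "n - 1 \<le> n - card ?F" by simp
  moreover have fin: "finite ?F" by simp
  \<comment> \<open>This bound is needed because subtraction on naturals truncates.\<close>
  moreover have "card ?F \<le> card {1..n}" by (intro card_mono) auto
  ultimately have "card ?F \<le> Suc 0" using n_pos by simp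
  moreover have "inv \<one> \<otimes> ?b = ?b" using b by simp
  then have "k \<in> ?F" "l \<in> ?F" using k l eq by simp_all
  ultimately show "k = l" using card_le_Suc0_iff_eq[OF fin] by blast
qed

text \<open>Row \<open>i\<close> is read off \<open>pinv (c i)\<close>, because
  \<open>dm_code\<close> inverts row permutations; \<open>c 1 = id\<close> makes row 1 the
  enumeration \<open>g\<close>.\<close>

lemma dm_code_surj:
  assumes C: "C \<in> invariant_codes m" and "m \<ge> 1"
  obtains D where "D \<in> normalized_dms G g n m" "dm_code G g n m D = C"
proof -
  obtain c where c1: "c 1 = id" and CU: "C = (\<Union>i\<in>{1..m}. lcoset (c i))"
    and disj: "\<And>i j. i \<in> {1..m} \<Longrightarrow> j \<in> {1..m} \<Longrightarrow> i \<noteq> j \<Longrightarrow> lcoset (c i) \<inter> lcoset (c j) = {}"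
    using invariant_code_representatives[OF assms] by metis
  have dist: "enat (n - 1) \<le> min_dist n C" and CB: "C \<subseteq> B1 n"
    using C by (auto simp: invariant_codes_def)
  have sub: "lcoset (c i) \<subseteq> C" if "i \<in> {1..m}" for i using that CU by blast
  have c: "c i permutes {1..n}" if "i \<in> {1..m}" for i
    using sub[OF that] CB lcoset_self unfolding B1_def by blast
  have pc: "pinv (c i) permutes {1..n}" if "i \<in> {1..m}" for i
    using c[OF that] by (rule permutes_inv)
  have ppc: "pinv (pinv (c i)) = c i" if "i \<in> {1..m}" for i
    using permutes_inv_inv[OF c[OF that]] .
  have in_n: "pinv (c i) k \<in> {1..n}" if "i \<in> {1..m}" "k \<in> {1..n}" for i k
    using pc[OF that(1)] that(2) by (simp only: permutes_in_image)
  define D where "D = restrict (\<lambda>(i, k). if i = 0 then \<one> else g (pinv (c i) k)) ({0..m} \<times> {1..n})"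
  have D0: "D (0, k) = \<one>" if "k \<in> {1..n}" for k using that by (simp add: D_def)
  have Di: "D (i, k) = g (pinv (c i) k)" if "i \<in> {1..m}" "k \<in> {1..n}" for i k
    using that by (simp add: D_def)
  have Dcl: "D \<in> {0..m} \<times> {1..n} \<rightarrow>\<^sub>E carrier G"
  proof (rule PiE_I)
    fix x assume "x \<in> {0..m} \<times> {1..n}"
    then obtain i k where x: "x = (i, k)" "i \<in> {0..m}" "k \<in> {1..n}" by blast
    show "D x \<in> carrier G"
    proof (cases "i = 0")
      case True then show ?thesis using x D0 by simp
    next
      case False
      then have "i \<in> {1..m}" using x by auto
      then show ?thesis using x Di in_n g_closed by metis
    qed
  qed (simp add: D_def)
  then have Dik: "D (i, k) \<in> carrier G" if "i \<in> {0..m}" "k \<in> {1..n}" for i k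
    using that by (auto simp: PiE_def)
  have injD: "inj_on (\<lambda>k. D (i, k)) {1..n}" if i: "i \<in> {1..m}" for i
  proof (rule inj_onI)
    fix k l assume "k \<in> {1..n}" "l \<in> {1..n}" "D (i, k) = D (i, l)"
    then have "pinv (c i) k = pinv (c i) l"
      using i Di in_n g_eq_iff by metis
    then show "k = l" using permutes_inj[OF pc[OF i]] by (simp add: inj_def)
  qed
  have "bij_betw (\<lambda>k. inv (D (i, k)) \<otimes> D (j, k)) {1..n} (carrier G)"
    if ij: "i \<in> {0..m}" "j \<in> {0..m}" "i \<noteq> j" for i j
  proof -
    \<comment> \<open>Injectivity is enough, since \<open>{1..n}\<close> and the group have the same
      finite cardinality. Row 0 does not come from the code and is treated separately.\<close>
    have "inj_on (\<lambda>k. inv (D (i, k)) \<otimes> D (j, k)) {1..n}"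
    proof -
      consider "i = 0" | "j = 0" | "i \<in> {1..m}" "j \<in> {1..m}" using ij by fastforce
      then show ?thesis
      proof cases
        case 1
        then have "j \<in> {1..m}" using ij by auto
        moreover have "inv (D (i, k)) \<otimes> D (j, k) = D (j, k)" if "k \<in> {1..n}" for k
          using 1 D0[OF that] Dik[OF ij(2) that] by simp
        ultimately show ?thesis using injD by (simp del: atLeastAtMost_iff cong: inj_on_cong)
      next
        case 2
        then have i: "i \<in> {1..m}" using ij by auto
        have "inv (D (i, k)) \<otimes> D (j, k) = inv (D (i, k))" if "k \<in> {1..n}" for k
          using 2 D0[OF that] Dik[OF ij(1) that] by simp
        moreover have "inj_on (\<lambda>k. inv (D (i, k))) {1..n}"
        proof (rule inj_onI)
          fix k l assume kl: "k \<in> {1..n}" "l \<in> {1..n}" "inv (D (i, k)) = inv (D (i, l))"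
          then have "D (i, k) = D (i, l)" using Dik[OF ij(1)] by (metis inv_inv)
          then show "k = l" using inj_onD[OF injD[OF i]] kl by blast
        qed
        ultimately show ?thesis by (simp del: atLeastAtMost_iff cong: inj_on_cong)
      next
        case 3
        have "inj_on (\<lambda>k. inv (g (pinv (c i) k)) \<otimes> g (pinv (c j) k)) {1..n}"
          using 3 ij sub disj
          by (intro inj_on_quotient_rows[OF dist] pc) (simp_all add: ppc del: atLeastAtMost_iff)
        then show ?thesis using Di 3 by (simp del: atLeastAtMost_iff cong: inj_on_cong)
      qed
    qed
    moreover have "(\<lambda>k. inv (D (i, k)) \<otimes> D (j, k)) ` {1..n} \<subseteq> carrier G"
      using Dik ij by auto
    ultimately show ?thesis
      unfolding bij_betw_def using card_carrier finite_carrier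
      by (simp add: card_image card_subset_eq)
  qed
  then have "D \<in> normalized_dms G g n m"
    using Dcl D0 Di[of 1] \<open>m \<ge> 1\<close> c1
    by (auto simp: normalized_dms_def difference_matrix_def)
  moreover have row: "row_perm g n D i = pinv (c i)" if i: "i \<in> {1..m}" for i
  proof
    fix k show "row_perm g n D i k = pinv (c i) k"
    proof (cases "k \<in> {1..n}")
      case True
      then have "row_perm g n D i k = idx (g (pinv (c i) k))"
        using Di[OF i] by (simp add: row_perm_def)
      then show ?thesis using idx_g[OF in_n[OF i True]] by simp
    next
      case False
      then show ?thesis using permutes_not_in[OF pc[OF i]] unfolding row_perm_def by (simp del: atLeastAtMost_iff)
    qed
  qed
  have "dm_code G g n m D = C"
    unfolding dm_code_eq CU using row ppc by (simp del: atLeastAtMost_iff)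
  ultimately show ?thesis using that by blast
qed

section \<open>The correspondence\<close>

text \<open>The code is constant on a class, so the image of the class is a singleton and
  \<open>the_elem\<close> extracts its value. For \<open>n = 1\<close> and \<open>m \<ge> 2\<close>
  there is a normalized matrix, but \<open>B1 n\<close> is too small for a code of size
  \<open>m\<close>.\<close>

lemma bij_betw_dm_code:
  assumes "m \<ge> 1" and nm: "n \<ge> 2 \<or> m = 1"
  shows "bij_betw (\<lambda>X. the_elem (dm_code G g n m ` X))
    (normalized_dms G g n m // dm_equiv G g n m) (invariant_codes m)"
proof -
  let ?N = "normalized_dms G g n m" and ?E = "dm_equiv G g n m"
  have val: "the_elem (dm_code G g n m ` (?E `` {D})) = dm_code G g n m D" if "D \<in> ?N" for D
  proof -
    have "D \<in> ?E `` {D}" using equiv_class_self[OF equiv_dm_equiv that] .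
    then have "dm_code G g n m ` (?E `` {D}) = {dm_code G g n m D}"
      using dm_code_eq_of_equiv by blast
    then show ?thesis by simp
  qed
  show ?thesis
    unfolding bij_betw_def
  proof
    show "inj_on (\<lambda>X. the_elem (dm_code G g n m ` X)) (?N // ?E)"
    proof (rule inj_onI)
      fix X Y assume "X \<in> ?N // ?E" "Y \<in> ?N // ?E"
        and eq: "the_elem (dm_code G g n m ` X) = the_elem (dm_code G g n m ` Y)"
      then obtain D D' where D: "D \<in> ?N" "X = ?E `` {D}" and D': "D' \<in> ?N" "Y = ?E `` {D'}"
        by (auto elim!: quotientE)
      then have "(D, D') \<in> ?E"
        using equiv_of_dm_code_eq[OF _ _ _ nm \<open>m \<ge> 1\<close>] eq val by simp
      then show "X = Y" using D D' equiv_class_eq[OF equiv_dm_equiv] by simp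
    qed
    have "(\<lambda>X. the_elem (dm_code G g n m ` X)) ` (?N // ?E) = dm_code G g n m ` ?N"
      using val by (force simp: quotient_def)
    also have "\<dots> = invariant_codes m"
      using dm_code_mem[OF _ assms] dm_code_surj[OF _ \<open>m \<ge> 1\<close>] by blast
    finally show "(\<lambda>X. the_elem (dm_code G g n m ` X)) ` (?N // ?E) = invariant_codes m" .
  qed
qed

text \<open>Every such code comes from a matrix, and there rows 1 and 2 show that the bound is
  attained.\<close>

lemma min_dist_invariant_code:
  assumes "C \<in> invariant_codes m" "n \<ge> 2" "m \<ge> 2"
  shows "min_dist n C = enat (n - 1)"
  using dm_code_surj[OF assms(1)] min_dist_dm_code_eq assms by (metis one_le_numeral order_trans)

end

theorem theorem1:
  fixes G :: "('a, 'b) monoid_scheme" and g :: "nat \<Rightarrow> 'a" and n m :: nat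
  assumes "group G"
    and "finite (carrier G)"
    and "order G = n"
    and "bij_betw g {1..n} (carrier G)"
    and "g 1 = \<one>\<^bsub>G\<^esub>"
    and "m \<ge> 1"
    and "n \<ge> 2 \<or> m = 1"
  shows "equiv (normalized_dms G g n m) (dm_equiv G g n m) \<and>
    dm_code G g n m respects dm_equiv G g n m \<and>
    bij_betw (\<lambda>X. the_elem (dm_code G g n m ` X))
      (normalized_dms G g n m // dm_equiv G g n m)
      {C. C \<subseteq> B1 n \<and> code_invariant n (PhiR G g n) C \<and> card C = m * n \<and>
          min_dist n C \<ge> enat (n - 1) \<and> PhiR G g n \<subseteq> C} \<and>
    (m \<ge> 2 \<longrightarrow>
      bij_betw (\<lambda>X. the_elem (dm_code G g n m ` X))
        (normalized_dms G g n m // dm_equiv G g n m)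
        {C. C \<subseteq> B1 n \<and> code_invariant n (PhiR G g n) C \<and> card C = m * n \<and>
            min_dist n C = enat (n - 1) \<and> PhiR G g n \<subseteq> C})"
proof -
  interpret enumerated_group G g n
    using assms(1,4) by (intro enumerated_group.intro enumerated_group_axioms.intro)
  have bij: "bij_betw (\<lambda>X. the_elem (dm_code G g n m ` X))
      (normalized_dms G g n m // dm_equiv G g n m) (invariant_codes m)"
    using assms(6,7) by (rule bij_betw_dm_code)
  have "invariant_codes m = {C. C \<subseteq> B1 n \<and> code_invariant n (PhiR G g n) C \<and> card C = m * n \<and>
      min_dist n C = enat (n - 1) \<and> PhiR G g n \<subseteq> C}" if "m \<ge> 2"
  proof -
    \<comment> \<open>For \<open>m \<ge> 2\<close> the lower bound on the distance is automatically
      an equality, so both sets of codes agree.\<close>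
    have "n \<ge> 2" using that assms(7) by auto
    then have "min_dist n C = enat (n - 1)" if "C \<in> invariant_codes m" for C
      using that \<open>m \<ge> 2\<close> by (intro min_dist_invariant_code)
    then show ?thesis by (auto simp: invariant_codes_def)
  qed
  moreover have "dm_code G g n m respects dm_equiv G g n m"
    using dm_code_eq_of_equiv by (auto simp: congruent_def)
  ultimately show ?thesis
    using equiv_dm_equiv[of m] bij bij[unfolded invariant_codes_def] by (intro conjI impI) simp_all
qed

end
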